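(* For any $p,q,r\in\mathbb{Z}_+$ and $\ell\in\mathbb{Z}$, the function $a_{p,q,r,\ell}$ belongs to the Hörmander class $S^{\vartheta(p,q,r,\ell)}_{\frac23,\frac13}([0,2P]\times(0,\infty))$, where $$\vartheta(p,q,r,\ell)=-\frac{1+2p+3q+r+\ell}{3}+(\ell+1)_-+\begin{cases}0, & 1+\ell-2r-p<0,\\ \frac{1+\ell-2r-p}{3}, & 1+\ell-2r-p\ge 0.\end{cases}$$
   Context: $\mathbb{Z}_+=\{0,1,2,\ldots\}$ and $t_-=\min\{t,0\}$. Let $P>0$ and $0<t_1<t_2<2P$ with $t_1+t_2=2P$ (these are the arc length parameters of the two shadow boundary points of a smooth compact strictly convex planar obstacle of perimeter $2P$). For $p,q,r\in\mathbb{Z}_+$, $\ell\in\mathbb{Z}$, $s\in[0,2P]$, $k>0$, $$a_{p,q,r,\ell}(s,k)=k^{-\frac{1+2p+3q+r+\ell}{3}+(\ell+1)_-}\,b_{p,q,r,\ell}(s)\,(\Psi^{r,\ell})^{(p)}(k^{\frac13}Z(s)),$$ the terms of the asymptotic expansion of the slow envelope of the total field in sound-hard scattering. Here: $b_{p,q,r,\ell}$ are $2P$-periodic complex-valued $C^\infty$ functions; $Z$ is a $2P$-periodic real-valued $C^\infty$ function that is positive on the illuminated region $(t_1,t_2)$, negative on the shadow region $[0,t_1)\cup(t_2,2P]$, and vanishes precisely to first order at $t_1$ and $t_2$; $\Psi^{r,\ell}:\mathbb{R}\to\mathbb{C}$ are $C^\infty$ functions with asymptotic expansions $\Psi^{r,\ell}(\tau)\sim\sum_{j\in\mathbb{Z}_+}a_{r,\ell,j}\tau^{1+\ell-2r-3j}$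 as $\tau\to+\infty$ (in the sense of symbols, i.e. the expansion may be differentiated term by term) and which, with all derivatives, decrease rapidly as $\tau\to-\infty$. Hörmander class: a $C^\infty$ function $a(s,k)$ on $[0,2P]\times(0,\infty)$ belongs to $S^{\mu}_{\varrho,\delta}([0,2P]\times(0,\infty))$ if for all $n,m\in\mathbb{Z}_+$ and every $k_0>0$ there is a constant $C$ with $|D_s^nD_k^m a(s,k)|\le C\,k^{\mu+\delta n-\varrho m}$ for all $s\in[0,2P]$, $k\ge k_0$. *)

theory Defs
  imports "HOL-Analysis.Analysis" "HOL-Library.Landau_Symbols" "HOL-Library.Periodic_Fun"
begin

definition vderiv :: "(real \<Rightarrow> 'a::real_normed_vector) \<Rightarrow> real \<Rightarrow> 'a" where
  "vderiv f = (\<lambda>x. vector_derivative f (at x))"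

definition smooth :: "(real \<Rightarrow> 'a::real_normed_vector) \<Rightarrow> bool" where
  "smooth f \<longleftrightarrow> (\<forall>n x. ((vderiv ^^ n) f) differentiable (at x))"

text \<open>
  Partial derivatives of a function of two real variables on a product \<open>S \<times> T\<close>.
  Derivatives are taken within \<open>S\<close> and \<open>T\<close>, so they are one-sided at
  endpoints belonging to these sets. As only norms of derivatives are estimated below, the
  customary factor of \<open>-\<i>\<close> in the symbol \<open>D\<close> is omitted.
\<close>

definition partial1 ::
  "real set \<Rightarrow> (real \<Rightarrow> real \<Rightarrow> 'a::real_normed_vector) \<Rightarrow> real \<Rightarrow> real \<Rightarrow> 'a" where
  "partial1 S a = (\<lambda>s k. vector_derivative (\<lambda>s'. a s' k) (at s within S))"

definition partial2 ::
  "real set \<Rightarrow> (real \<Rightarrow> real \<Rightarrow> 'a::real_normed_vector) \<Rightarrow> real \<Rightarrow> real \<Rightarrow> 'a" where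
  "partial2 T a = (\<lambda>s k. vector_derivative (\<lambda>k'. a s k') (at k within T))"

primrec C_diff_on2 ::
  "nat \<Rightarrow> real set \<Rightarrow> real set \<Rightarrow> (real \<Rightarrow> real \<Rightarrow> 'a::real_normed_vector) \<Rightarrow> bool" where
  "C_diff_on2 0 S T a \<longleftrightarrow> continuous_on (S \<times> T) (\<lambda>(s, k). a s k)"
| "C_diff_on2 (Suc n) S T a \<longleftrightarrow>
     continuous_on (S \<times> T) (\<lambda>(s, k). a s k) \<and>
     (\<forall>s\<in>S. \<forall>k\<in>T. (\<lambda>s'. a s' k) differentiable (at s within S) \<and>
                    (\<lambda>k'. a s k') differentiable (at k within T)) \<and>
     C_diff_on2 n S T (partial1 S a) \<and> C_diff_on2 n S T (partial2 T a)"

definition smooth_on2 ::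
  "real set \<Rightarrow> real set \<Rightarrow> (real \<Rightarrow> real \<Rightarrow> 'a::real_normed_vector) \<Rightarrow> bool" where
  "smooth_on2 S T a \<longleftrightarrow> (\<forall>n. C_diff_on2 n S T a)"

text \<open>The class \<open>S\<^sup>\<mu>\<close> of type \<open>\<rho>, \<delta>\<close> on \<open>S \<times> (0, \<infinity>)\<close>.\<close>

definition hormander_class ::
  "real \<Rightarrow> real \<Rightarrow> real \<Rightarrow> real set \<Rightarrow> (real \<Rightarrow> real \<Rightarrow> complex) set" where
  "hormander_class \<mu> \<rho> \<delta> S =
     {a. smooth_on2 S {0<..} a \<and>
         (\<forall>n m. \<forall>k0>0. \<exists>C. \<forall>s\<in>S. \<forall>k\<ge>k0.
            norm ((partial1 S ^^ n) ((partial2 {0<..} ^^ m) a) s k)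
              \<le> C * k powr (\<mu> + \<delta> * real n - \<rho> * real m))}"

text \<open>
  \<open>f(\<tau>) \<sim> (\<Sum>j. c j \<tau>\<^bsup>e - 3j\<^esup>)\<close> as \<open>\<tau> \<rightarrow> +\<infinity>\<close> in the sense of symbols.
\<close>

definition symbol_expansion :: "(real \<Rightarrow> complex) \<Rightarrow> int \<Rightarrow> (nat \<Rightarrow> complex) \<Rightarrow> bool" where
  "symbol_expansion f e c \<longleftrightarrow>
     (\<forall>N n. (\<lambda>\<tau>. norm ((vderiv ^^ n)
               (\<lambda>t. f t - (\<Sum>j<N. c j * of_real (t powi (e - 3 * int j)))) \<tau>))
            \<in> O[at_top](\<lambda>\<tau>. \<tau> powi (e - 3 * int N - int n)))"

definition rapidly_decreasing_at_bot :: "(real \<Rightarrow> complex) \<Rightarrow> bool" where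
  "rapidly_decreasing_at_bot f \<longleftrightarrow>
     (\<forall>n N. (\<lambda>\<tau>. norm ((vderiv ^^ n) f \<tau>)) \<in> O[at_bot](\<lambda>\<tau>. \<bar>\<tau>\<bar> powi (- int N)))"

definition neg_part :: "real \<Rightarrow> real" where
  "neg_part t = min t 0"

definition base_exponent :: "nat \<Rightarrow> nat \<Rightarrow> nat \<Rightarrow> int \<Rightarrow> real" where
  "base_exponent p q r l =
     - (1 + 2 * real p + 3 * real q + real r + real_of_int l) / 3 + neg_part (real_of_int l + 1)"

definition expansion_term ::
  "(nat \<Rightarrow> nat \<Rightarrow> nat \<Rightarrow> int \<Rightarrow> real \<Rightarrow> complex) \<Rightarrow> (nat \<Rightarrow> int \<Rightarrow> real \<Rightarrow> complex) \<Rightarrow> (real \<Rightarrow> real) \<Rightarrow>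
   nat \<Rightarrow> nat \<Rightarrow> nat \<Rightarrow> int \<Rightarrow> real \<Rightarrow> real \<Rightarrow> complex" where
  "expansion_term b \<Psi> Z p q r l = (\<lambda>s k.
     of_real (k powr base_exponent p q r l) * b p q r l s *
     (vderiv ^^ p) (\<Psi> r l) (k powr (1/3) * Z s))"

definition symbol_order :: "nat \<Rightarrow> nat \<Rightarrow> nat \<Rightarrow> int \<Rightarrow> real" where
  "symbol_order p q r l = base_exponent p q r l +
     (let e = 1 + l - 2 * int r - int p in if e < 0 then 0 else real_of_int e / 3)"

end

theory Submission
  imports Defs
begin

text \<open>
  Put \<open>F = \<Psi>\<^sup>(\<^sup>p\<^sup>)\<close>, \<open>e = 1 + l - 2 r - p\<close>, \<open>d = max e 0\<close> and \<open>\<tau> = k\<^bsup>1/3\<^esup> Z(s)\<close>, so that the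
  term is \<open>k\<^bsup>\<beta>\<^esup> b(s) F(\<tau>)\<close>. Two observations give the estimate.

  The first concerns \<open>F\<close> alone. Its \<open>n\<close>-th derivative is \<open>O(\<tau>\<^bsup>e-n\<^esup>)\<close> at \<open>+\<infinity>\<close> by the symbol
  expansion, rapidly decreasing at \<open>-\<infinity>\<close>, and bounded in between; hence
  \<open>(1 + |\<tau>|)\<^sup>n |F\<^sup>(\<^sup>n\<^sup>)(\<tau>)| \<le> C (1 + |\<tau>|)\<^sup>d\<close> on the whole line (\<open>symbol_bound_from_ends\<close>).
  In particular each \<open>\<tau>\<^sup>i F\<^sup>(\<^sup>i\<^sup>+\<^sup>j\<^sup>)(\<tau>)\<close> is \<open>O((1 + |\<tau>|)\<^sup>d)\<close>. Since \<open>Z\<close> is bounded, this is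
  \<open>O(k\<^bsup>d/3\<^esup>)\<close> for \<open>k \<ge> k0\<close>, which accounts for the last summand of the order.

  The second is that the functions \<open>k\<^bsup>\<gamma>\<^esup> b(s) \<tau>\<^sup>i F\<^sup>(\<^sup>i\<^sup>+\<^sup>j\<^sup>)(\<tau>)\<close> span a space closed under both
  derivatives. As \<open>\<partial>\<tau>/\<partial>s = k\<^bsup>1/3\<^esup> Z'(s)\<close>, an \<open>s\<close>-derivative raises \<open>\<gamma>\<close> by at most \<open>1/3\<close>
  (\<open>amplitude_partial1\<close>). As \<open>\<partial>\<tau>/\<partial>k = \<tau>/(3 k)\<close>, a \<open>k\<close>-derivative costs a factor \<open>1/k\<close>, and
  the new factor \<open>\<tau>\<close> is matched by the new derivative of \<open>F\<close>, so that \<open>\<gamma>\<close> drops by a full \<open>1\<close>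
  (\<open>amplitude_partial2\<close>). For \<open>k \<ge> k0\<close> this is better than the required gain of \<open>2/3\<close>.
\<close>

section \<open>Smooth functions of one variable\<close>

lemma smooth_iterate: "smooth f \<Longrightarrow> smooth ((vderiv ^^ n) f)"
  unfolding smooth_def by (metis comp_apply funpow_add)

lemma smooth_vderiv: "smooth f \<Longrightarrow> smooth (vderiv f)"
  using smooth_iterate[of f 1] by simp

lemma smooth_has_vector_derivative:
  "smooth f \<Longrightarrow> (f has_vector_derivative vderiv f x) (at x within A)"
  unfolding smooth_def vderiv_def
  by (metis funpow_0 has_vector_derivative_at_within vector_derivative_works)

lemma smooth_continuous_on: "smooth f \<Longrightarrow> continuous_on A f"
  using smooth_has_vector_derivative has_vector_derivative_continuous
  by (metis continuous_at_imp_continuous_on)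

lemma vderiv_unique: "(\<And>x. (f has_vector_derivative f' x) (at x)) \<Longrightarrow> vderiv f = f'"
  unfolding vderiv_def using vector_derivative_at by blast

text \<open>
  Iterated derivatives of a product are sums with growing numbers of terms. Coinduction avoids the
  Leibniz formula: it is enough to find a class of differentiable functions that contains the
  product and is closed under differentiation.
\<close>

lemma smooth_coinduct:
  assumes "X f"
    and step: "\<And>f. X f \<Longrightarrow> (\<forall>x. f differentiable at x) \<and> X (vderiv f)"
  shows "smooth f"
proof -
  have "X ((vderiv ^^ n) f)" for n
    by (induction n) (use assms in auto)
  with step show ?thesis
    unfolding smooth_def by blast
qed

inductive sum_of_smooth_products :: "(real \<Rightarrow> 'a::real_normed_vector) \<Rightarrow> bool" where
  product: "smooth f \<Longrightarrow> smooth g \<Longrightarrow> sum_of_smooth_products (\<lambda>x. f x *\<^sub>R g x)"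
| sum: "sum_of_smooth_products f \<Longrightarrow> sum_of_smooth_products g \<Longrightarrow>
    sum_of_smooth_products (\<lambda>x. f x + g x)"

lemma sum_of_smooth_products_step:
  assumes "sum_of_smooth_products f"
  shows "(\<forall>x. f differentiable at x) \<and> sum_of_smooth_products (vderiv f)"
  using assms
proof induction
  case (product f g)
  have D: "((\<lambda>x. f x *\<^sub>R g x) has_vector_derivative f x *\<^sub>R vderiv g x + vderiv f x *\<^sub>R g x) (at x)" for x
    using product
    by (intro has_vector_derivative_scaleR smooth_has_vector_derivative)
       (auto simp: has_real_derivative_iff_has_vector_derivative smooth_has_vector_derivative)
  then have "vderiv (\<lambda>x. f x *\<^sub>R g x) = (\<lambda>x. f x *\<^sub>R vderiv g x + vderiv f x *\<^sub>R g x)"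
    by (rule vderiv_unique)
  moreover have "sum_of_smooth_products (\<lambda>x. f x *\<^sub>R vderiv g x + vderiv f x *\<^sub>R g x)"
    using product by (intro sum_of_smooth_products.intros smooth_vderiv)
  ultimately show ?case
    using D differentiableI_vector by metis
next
  case (sum f g)
  have "((\<lambda>x. f x + g x) has_vector_derivative vderiv f x + vderiv g x) (at x)" for x
    using sum.IH unfolding vderiv_def
    by (intro has_vector_derivative_add) (auto simp: vector_derivative_works[symmetric])
  then have "vderiv (\<lambda>x. f x + g x) = (\<lambda>x. vderiv f x + vderiv g x)"
    by (rule vderiv_unique)
  then show ?case
    using sum.IH sum_of_smooth_products.sum by auto
qed

lemma smooth_scaleR: "smooth f \<Longrightarrow> smooth g \<Longrightarrow> smooth (\<lambda>x. f x *\<^sub>R g x)"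
  using smooth_coinduct[of sum_of_smooth_products] sum_of_smooth_products_step
    sum_of_smooth_products.product by blast

section \<open>Amplitudes built from a symbol and a phase\<close>

text \<open>
  The bound says that \<open>F\<close> is a symbol of order \<open>d\<close>, uniformly on the whole line. Non-isolated
  points make the derivative within \<open>S\<close> unique, also at the end points of an interval.
\<close>

locale symbol_of_scaled_phase =
  fixes S :: "real set" and Z :: "real \<Rightarrow> real" and F :: "real \<Rightarrow> complex" and d :: nat
  assumes compact_S: "compact S"
    and not_isolated: "\<And>s. s \<in> S \<Longrightarrow> at s within S \<noteq> bot"
    and smooth_Z: "smooth Z" and smooth_F: "smooth F"
    and symbol_bound:
      "\<And>n. \<exists>C. \<forall>\<tau>. (1 + \<bar>\<tau>\<bar>) ^ n * norm ((vderiv ^^ n) F \<tau>) \<le> C * (1 + \<bar>\<tau>\<bar>) ^ d"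
begin

text \<open>
  The number of derivatives on \<open>F\<close> is written \<open>i + j\<close> because at least as many derivatives as
  factors \<open>\<tau>\<close> must be present: then the factors \<open>\<tau>\<close> do not spoil the bound, and both partial
  derivatives preserve this surplus \<open>j \<ge> 0\<close>.
\<close>

definition monomial :: "real \<Rightarrow> nat \<Rightarrow> nat \<Rightarrow> (real \<Rightarrow> complex) \<Rightarrow> real \<Rightarrow> real \<Rightarrow> complex" where
  "monomial \<gamma> i j b = (\<lambda>s k.
     (k powr \<gamma> * (k powr (1/3) * Z s) ^ i) *\<^sub>R (b s * (vderiv ^^ (i + j)) F (k powr (1/3) * Z s)))"

text \<open>
  Linear combinations of monomials with \<open>\<gamma> \<le> \<beta>\<close>. Equality is asked for on \<open>S \<times> (0, \<infinity>)\<close> only,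
  as partial derivatives within \<open>S\<close> carry no information at points outside \<open>S\<close>.
\<close>

inductive amplitude :: "real \<Rightarrow> (real \<Rightarrow> real \<Rightarrow> complex) \<Rightarrow> bool" where
  monomial: "smooth b \<Longrightarrow> \<gamma> \<le> \<beta> \<Longrightarrow> (\<And>s k. s \<in> S \<Longrightarrow> k > 0 \<Longrightarrow> a s k = c *\<^sub>R monomial \<gamma> i j b s k) \<Longrightarrow>
    amplitude \<beta> a"
| sum: "amplitude \<beta> a1 \<Longrightarrow> amplitude \<beta> a2 \<Longrightarrow>
    (\<And>s k. s \<in> S \<Longrightarrow> k > 0 \<Longrightarrow> a s k = a1 s k + a2 s k) \<Longrightarrow> amplitude \<beta> a"

lemma amplitude_cong:
  assumes "amplitude \<beta> a" "\<And>s k. s \<in> S \<Longrightarrow> k > 0 \<Longrightarrow> a' s k = a s k"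
  shows "amplitude \<beta> a'"
  using assms(1)
proof cases
  case (monomial b \<gamma> c i j)
  show ?thesis
    by (rule amplitude.monomial[OF monomial(1,2)]) (simp only: assms(2) monomial(3))
next
  case (sum a1 a2)
  show ?thesis
    by (rule amplitude.sum[OF sum(1,2)]) (simp only: assms(2) sum(3))
qed

lemma amplitude_monomial: "smooth b \<Longrightarrow> \<gamma> \<le> \<beta> \<Longrightarrow> amplitude \<beta> (\<lambda>s k. c *\<^sub>R monomial \<gamma> i j b s k)"
  by (rule amplitude.monomial) auto

lemma amplitude_add:
  "amplitude \<beta> a1 \<Longrightarrow> amplitude \<beta> a2 \<Longrightarrow> amplitude \<beta> (\<lambda>s k. a1 s k + a2 s k)"
  by (rule amplitude.sum) auto

lemma iterate_F_has_vector_derivative: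
  "((vderiv ^^ n) F has_vector_derivative (vderiv ^^ Suc n) F x) (at x within A)"
  using smooth_has_vector_derivative[OF smooth_iterate[OF smooth_F]] by simp

lemma monomial_partial1:
  assumes b: "smooth b"
  shows "((\<lambda>s. monomial \<gamma> i j b s k) has_vector_derivative
     monomial \<gamma> i j (vderiv b) s k
     + (real i *\<^sub>R monomial (\<gamma> + 1/3) (i - 1) (Suc j) (\<lambda>s. vderiv Z s *\<^sub>R b s) s k
        + monomial (\<gamma> + 1/3) i (Suc j) (\<lambda>s. vderiv Z s *\<^sub>R b s) s k)) (at s within S)"
proof -
  have Z': "(Z has_real_derivative vderiv Z s) (at s within S)"
    using smooth_has_vector_derivative[OF smooth_Z]
    by (simp add: has_real_derivative_iff_has_vector_derivative)
  have F': "((vderiv ^^ (i + j)) F \<circ> (\<lambda>s. k powr (1/3) * Z s) has_vector_derivative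
      (k powr (1/3) * vderiv Z s) *\<^sub>R (vderiv ^^ Suc (i + j)) F (k powr (1/3) * Z s)) (at s within S)"
    by (intro vector_diff_chain_within iterate_F_has_vector_derivative)
       (use DERIV_cmult[OF Z'] in \<open>simp add: has_real_derivative_iff_has_vector_derivative\<close>)
  have pw: "((\<lambda>s. k powr \<gamma> * (k powr (1/3) * Z s) ^ i) has_real_derivative
      k powr \<gamma> * (real i * (k powr (1/3) * Z s) ^ (i - 1) * (k powr (1/3) * vderiv Z s))) (at s within S)"
    using Z' by (auto intro!: derivative_eq_intros)
  note D = has_vector_derivative_scaleR[OF pw
      has_vector_derivative_mult[OF smooth_has_vector_derivative[OF b, of s S] F'], unfolded comp_def]
  show ?thesis
    unfolding monomial_def
  proof (rule has_vector_derivative_eq_rhs[OF D], goal_cases)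
    case 1
    \<comment> \<open>For \<open>i = 0\<close> the term with the truncated exponent \<open>i - 1\<close> has the coefficient \<open>0\<close>.\<close>
    have "i = 0 \<or> i - 1 + Suc j = i + j"
      by auto
    then show ?case
      unfolding powr_add add_Suc_right
      by (elim disjE) (simp_all only: scaleR_conv_of_real of_real_mult mult_ac distrib_left distrib_right, simp_all)
  qed
qed

text \<open>
  The exponent of \<open>k\<close> drops by a full \<open>1\<close>: the chain rule produces \<open>\<tau> / (3 k)\<close>, and this \<open>\<tau>\<close>
  joins the power \<open>\<tau>\<^sup>i\<close> while \<open>F\<close> is differentiated once more.
\<close>

lemma monomial_partial2:
  assumes k: "k > 0"
  shows "((\<lambda>k. monomial \<gamma> i j b s k) has_vector_derivative
     (\<gamma> + real i / 3) *\<^sub>R monomial (\<gamma> - 1) i j b s k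
     + (1/3) *\<^sub>R monomial (\<gamma> - 1) (Suc i) j b s k) (at k)"
proof -
  have root: "((\<lambda>k. k powr (1/3) * Z s) has_real_derivative (1/3) * (k powr (1/3) * Z s) / k) (at k)"
    by (rule DERIV_cong[OF DERIV_cmult_right[OF has_real_derivative_powr[OF k]]])
       (use k powr_diff[of k "1/3" 1] in simp)
  have F': "((vderiv ^^ (i + j)) F \<circ> (\<lambda>k. k powr (1/3) * Z s) has_vector_derivative
      ((1/3) * (k powr (1/3) * Z s) / k) *\<^sub>R (vderiv ^^ Suc (i + j)) F (k powr (1/3) * Z s)) (at k)"
    by (intro vector_diff_chain_within iterate_F_has_vector_derivative)
       (use root in \<open>simp add: has_real_derivative_iff_has_vector_derivative\<close>)
  have pw: "((\<lambda>k. k powr \<gamma> * (k powr (1/3) * Z s) ^ i) has_real_derivative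
      (\<gamma> + real i / 3) * (k powr (\<gamma> - 1) * (k powr (1/3) * Z s) ^ i)) (at k)"
  proof -
    have "i = 0 \<or> (k powr (1/3) * Z s) ^ i = (k powr (1/3) * Z s) * (k powr (1/3) * Z s) ^ (i - 1)"
      by (cases i) auto
    moreover have "((\<lambda>k. k powr \<gamma>) has_real_derivative \<gamma> * k powr (\<gamma> - 1)) (at k)"
      using k by (auto intro!: derivative_eq_intros)
    ultimately show ?thesis
      using k by (intro DERIV_cong[OF DERIV_mult[OF _ DERIV_power[OF root, of i]]])
        (auto simp: powr_diff field_simps)
  qed
  have pull_out: "k powr (\<gamma> - 1) = k powr \<gamma> / k"
    using k by (simp add: powr_diff)
  note D = has_vector_derivative_scaleR[OF pw has_vector_derivative_mult_right[OF F', of "b s"],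
      unfolded comp_def]
  show ?thesis
    unfolding monomial_def
    by (rule has_vector_derivative_eq_rhs[OF D])
       (simp add: pull_out scaleR_conv_of_real algebra_simps del: funpow.simps)
qed

lemma amplitude_partial1:
  assumes "amplitude \<beta> a"
  shows "\<exists>a'. amplitude (\<beta> + 1/3) a' \<and>
    (\<forall>s\<in>S. \<forall>k>0. ((\<lambda>s. a s k) has_vector_derivative a' s k) (at s within S))"
  using assms
proof induction
  case (monomial b \<gamma> \<beta> a c i j)
  define a' where "a' = (\<lambda>s k. c *\<^sub>R monomial \<gamma> i j (vderiv b) s k
     + ((c * real i) *\<^sub>R monomial (\<gamma> + 1/3) (i - 1) (Suc j) (\<lambda>s. vderiv Z s *\<^sub>R b s) s k
        + c *\<^sub>R monomial (\<gamma> + 1/3) i (Suc j) (\<lambda>s. vderiv Z s *\<^sub>R b s) s k))"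
  have "amplitude (\<beta> + 1/3) a'"
    unfolding a'_def using monomial(1,2)
    by (intro amplitude_add amplitude_monomial smooth_scaleR smooth_vderiv smooth_Z) auto
  moreover have "((\<lambda>s. a s k) has_vector_derivative a' s k) (at s within S)" if "s \<in> S" "k > 0" for s k
  proof (rule has_vector_derivative_transform[OF that(1)])
    show "((\<lambda>s. c *\<^sub>R monomial \<gamma> i j b s k) has_vector_derivative a' s k) (at s within S)"
      unfolding a'_def
      using bounded_linear.has_vector_derivative[OF bounded_linear_scaleR_right
          monomial_partial1[OF monomial(1)], of c \<gamma> i j k s]
      by (simp add: scaleR_add_right)
  qed (use monomial that in auto)
  ultimately show ?case
    by (intro exI[of _ a'] conjI ballI allI impI)
next
  case (sum \<beta> a1 a2 a)
  then obtain a1' a2' where A: "amplitude (\<beta> + 1/3) a1'" "amplitude (\<beta> + 1/3) a2'"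
    and D: "\<And>s k. s \<in> S \<Longrightarrow> k > 0 \<Longrightarrow> ((\<lambda>s. a1 s k) has_vector_derivative a1' s k) (at s within S)"
      "\<And>s k. s \<in> S \<Longrightarrow> k > 0 \<Longrightarrow> ((\<lambda>s. a2 s k) has_vector_derivative a2' s k) (at s within S)"
    by (elim exE conjE) simp
  have "((\<lambda>s. a s k) has_vector_derivative a1' s k + a2' s k) (at s within S)"
    if "s \<in> S" "k > 0" for s k
    by (rule has_vector_derivative_transform[OF that(1) _ has_vector_derivative_add[OF D[OF that]]])
       (use sum.hyps(3) that in auto)
  then show ?case
    by (intro exI[of _ "\<lambda>s k. a1' s k + a2' s k"] conjI ballI allI impI amplitude_add A)
qed

lemma amplitude_partial2:
  assumes "amplitude \<beta> a"
  shows "\<exists>a'. amplitude (\<beta> - 1) a' \<and>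
    (\<forall>s\<in>S. \<forall>k>0. ((\<lambda>k. a s k) has_vector_derivative a' s k) (at k within {0<..}))"
  using assms
proof induction
  case (monomial b \<gamma> \<beta> a c i j)
  define a' where "a' = (\<lambda>s k. (c * (\<gamma> + real i / 3)) *\<^sub>R monomial (\<gamma> - 1) i j b s k
     + (c * (1/3)) *\<^sub>R monomial (\<gamma> - 1) (Suc i) j b s k)"
  have "amplitude (\<beta> - 1) a'"
    unfolding a'_def using monomial(1,2)
    by (intro amplitude_add amplitude_monomial) auto
  moreover have "((\<lambda>k. a s k) has_vector_derivative a' s k) (at k within {0<..})"
    if "s \<in> S" "k > 0" for s k
  proof (rule has_vector_derivative_transform)
    show "((\<lambda>k. c *\<^sub>R monomial \<gamma> i j b s k) has_vector_derivative a' s k) (at k within {0<..})"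
      unfolding a'_def
      using bounded_linear.has_vector_derivative[OF bounded_linear_scaleR_right
          has_vector_derivative_at_within[OF monomial_partial2[OF that(2)]], of c \<gamma> i j b s "{0<..}"]
      by (simp add: scaleR_add_right)
  qed (use monomial that in auto)
  ultimately show ?case
    by (intro exI[of _ a'] conjI ballI allI impI)
next
  case (sum \<beta> a1 a2 a)
  then obtain a1' a2' where A: "amplitude (\<beta> - 1) a1'" "amplitude (\<beta> - 1) a2'"
    and D: "\<And>s k. s \<in> S \<Longrightarrow> k > 0 \<Longrightarrow> ((\<lambda>k. a1 s k) has_vector_derivative a1' s k) (at k within {0<..})"
      "\<And>s k. s \<in> S \<Longrightarrow> k > 0 \<Longrightarrow> ((\<lambda>k. a2 s k) has_vector_derivative a2' s k) (at k within {0<..})"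
    by (elim exE conjE) simp
  have "((\<lambda>k. a s k) has_vector_derivative a1' s k + a2' s k) (at k within {0<..})"
    if "s \<in> S" "k > 0" for s k
    by (rule has_vector_derivative_transform[OF _ _ has_vector_derivative_add[OF D[OF that]]])
       (use sum.hyps(3) that in auto)
  then show ?case
    by (intro exI[of _ "\<lambda>s k. a1' s k + a2' s k"] conjI ballI allI impI amplitude_add A)
qed

lemma partial1_amplitude:
  assumes "amplitude \<beta> a"
  shows "amplitude (\<beta> + 1/3) (partial1 S a)"
proof -
  obtain a' where a': "amplitude (\<beta> + 1/3) a'"
    and D: "\<And>s k. s \<in> S \<Longrightarrow> k > 0 \<Longrightarrow> ((\<lambda>s. a s k) has_vector_derivative a' s k) (at s within S)"
    using amplitude_partial1[OF assms] by (elim exE conjE) simp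
  have "partial1 S a s k = a' s k" if "s \<in> S" "k > 0" for s k
    unfolding partial1_def by (rule vector_derivative_within[OF not_isolated D]) fact+
  then show ?thesis
    by (rule amplitude_cong[OF a'])
qed

lemma partial2_amplitude:
  assumes "amplitude \<beta> a"
  shows "amplitude (\<beta> - 1) (partial2 {0<..} a)"
proof -
  obtain a' where a': "amplitude (\<beta> - 1) a'"
    and D: "\<And>s k. s \<in> S \<Longrightarrow> k > 0 \<Longrightarrow> ((\<lambda>k. a s k) has_vector_derivative a' s k) (at k within {0<..})"
    using amplitude_partial2[OF assms] by (elim exE conjE) simp
  have "partial2 {0<..} a s k = a' s k" if "s \<in> S" "k > 0" for s k
    unfolding partial2_def using that
    by (intro vector_derivative_within[OF _ D]) (simp_all add: at_within_open[of k "{0<..}"])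
  then show ?thesis
    by (rule amplitude_cong[OF a'])
qed

lemma amplitude_iterated_partials:
  assumes "amplitude \<beta> a"
  shows "amplitude (\<beta> + real n / 3 - real m) ((partial1 S ^^ n) ((partial2 {0<..} ^^ m) a))"
proof -
  have "amplitude (\<beta> - real m) ((partial2 {0<..} ^^ m) a)"
  proof (induction m)
    case (Suc m)
    show ?case
      using partial2_amplitude[OF Suc] by (simp add: algebra_simps)
  qed (use assms in simp)
  then show ?thesis
  proof (induction n)
    case (Suc n)
    show ?case
      using partial1_amplitude[OF Suc.IH[OF Suc.prems]] by (simp add: field_simps)
  qed simp
qed

lemma amplitude_continuous:
  assumes "amplitude \<beta> a"
  shows "continuous_on (S \<times> {0<..}) (\<lambda>(s, k). a s k)"
  using assms
proof induction
  case (monomial b \<gamma> \<beta> a c i j)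
  have F: "continuous_on UNIV ((vderiv ^^ (i + j)) F)"
    using smooth_continuous_on smooth_iterate smooth_F by blast
  have "continuous_on (S \<times> {0<..}) (\<lambda>x. c *\<^sub>R monomial \<gamma> i j b (fst x) (snd x))"
    unfolding monomial_def
    by (intro continuous_intros continuous_on_compose2[OF F]
          continuous_on_compose2[OF smooth_continuous_on[OF smooth_Z, of UNIV]]
          continuous_on_compose2[OF smooth_continuous_on[OF monomial(1), of UNIV]]) auto
  then show ?case
    by (rule continuous_on_eq) (use monomial in auto)
next
  case (sum \<beta> a1 a2 a)
  have "continuous_on (S \<times> {0<..}) (\<lambda>x. (\<lambda>(s, k). a1 s k) x + (\<lambda>(s, k). a2 s k) x)"
    using sum.IH by (intro continuous_on_add)
  then show ?case
    by (rule continuous_on_eq) (use sum.hyps(3) in auto)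
qed

lemma amplitude_smooth: "amplitude \<beta> a \<Longrightarrow> smooth_on2 S {0<..} a"
proof -
  have "amplitude \<beta> a \<Longrightarrow> C_diff_on2 n S {0<..} a" for n \<beta> a
  proof (induction n arbitrary: \<beta> a)
    case (Suc n)
    have "\<forall>s\<in>S. \<forall>k\<in>{0<..}. (\<lambda>s'. a s' k) differentiable (at s within S) \<and>
                    (\<lambda>k'. a s k') differentiable (at k within {0<..})"
      using amplitude_partial1[OF Suc.prems] amplitude_partial2[OF Suc.prems]
      by (metis differentiableI_vector greaterThan_iff)
    then show ?case
      using Suc.IH[OF partial1_amplitude[OF Suc.prems]] Suc.IH[OF partial2_amplitude[OF Suc.prems]]
        amplitude_continuous[OF Suc.prems]
      by simp
  qed (auto intro: amplitude_continuous)
  then show "amplitude \<beta> a \<Longrightarrow> smooth_on2 S {0<..} a"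
    unfolding smooth_on2_def by blast
qed

lemma smooth_bounded:
  fixes f :: "real \<Rightarrow> 'b::real_normed_vector"
  assumes "smooth f"
  obtains B where "B \<ge> 0" "\<And>s. s \<in> S \<Longrightarrow> norm (f s) \<le> B"
proof -
  have "bounded (f ` S)"
    using compact_imp_bounded compact_continuous_image smooth_continuous_on assms compact_S by blast
  then obtain B where "B > 0" "\<forall>x\<in>f ` S. norm x \<le> B"
    unfolding bounded_pos by blast
  then show ?thesis
    using that[of B] by simp
qed

text \<open>
  The \<open>i\<close> factors \<open>\<tau>\<close> are absorbed by \<open>i\<close> of the derivatives of \<open>F\<close>. What is left is
  \<open>(1 + |\<tau>|)\<^sup>d\<close>, and \<open>1 + |\<tau>|\<close> is at most a constant times \<open>k\<^bsup>1/3\<^esup>\<close> because \<open>Z\<close> is bounded on \<open>S\<close>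
  and \<open>k\<close> stays away from \<open>0\<close>.
\<close>

lemma monomial_bound:
  assumes b: "smooth b" and k0: "k0 > 0"
  shows "\<exists>C. \<forall>s\<in>S. \<forall>k\<ge>k0. norm (monomial \<gamma> i j b s k) \<le> C * k powr (\<gamma> + real d / 3)"
proof -
  obtain B where B: "B \<ge> 0" "\<And>s. s \<in> S \<Longrightarrow> norm (b s) \<le> B"
    using smooth_bounded[OF b] by blast
  obtain M where M: "M \<ge> 0" "\<And>s. s \<in> S \<Longrightarrow> norm (Z s) \<le> M"
    using smooth_bounded[OF smooth_Z] by blast
  obtain C where C: "\<And>\<tau>. (1 + \<bar>\<tau>\<bar>) ^ (i + j) * norm ((vderiv ^^ (i + j)) F \<tau>) \<le> C * (1 + \<bar>\<tau>\<bar>) ^ d"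
    using symbol_bound by blast
  have "C \<ge> 0"
    using order_trans[OF _ C[of 0]] by simp
  \<comment> \<open>The summand \<open>k0 powr (-1/3)\<close> takes care of the \<open>1\<close> in \<open>1 + |\<tau>|\<close>, since \<open>1 \<le> (k / k0) powr (1/3)\<close>.\<close>
  define N where "N = k0 powr (-1/3) + M"
  have "norm (monomial \<gamma> i j b s k) \<le> (B * C * N ^ d) * k powr (\<gamma> + real d / 3)"
    if s: "s \<in> S" and k: "k \<ge> k0" for s k
  proof -
    define \<tau> where "\<tau> = k powr (1/3) * Z s"
    have "\<bar>\<tau>\<bar> ^ i \<le> (1 + \<bar>\<tau>\<bar>) ^ i * (1 + \<bar>\<tau>\<bar>) ^ j"
      using mult_mono[of "\<bar>\<tau>\<bar> ^ i" "(1 + \<bar>\<tau>\<bar>) ^ i" 1 "(1 + \<bar>\<tau>\<bar>) ^ j"]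
      by (simp add: power_mono)
    then have "\<bar>\<tau>\<bar> ^ i * norm ((vderiv ^^ (i + j)) F \<tau>) \<le> C * (1 + \<bar>\<tau>\<bar>) ^ d"
      by (intro order_trans[OF _ C[of \<tau>]] mult_right_mono) (auto simp: power_add)
    also have "1 + \<bar>\<tau>\<bar> \<le> N * k powr (1/3)"
    proof -
      have "k0 powr (-1/3) * k0 powr (1/3) \<le> k0 powr (-1/3) * k powr (1/3)"
        using k k0 by (intro mult_left_mono powr_mono2) auto
      then have "1 \<le> k0 powr (-1/3) * k powr (1/3)"
        using k0 by (simp add: powr_add[symmetric])
      moreover have "\<bar>\<tau>\<bar> \<le> M * k powr (1/3)"
        using M(2)[OF s] by (simp add: \<tau>_def abs_mult mult.commute mult_right_mono)
      ultimately show ?thesis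
        by (simp add: N_def algebra_simps)
    qed
    then have "C * (1 + \<bar>\<tau>\<bar>) ^ d \<le> C * (N * k powr (1/3)) ^ d"
      using \<open>C \<ge> 0\<close> by (intro mult_left_mono power_mono) auto
    finally have "norm (b s) * (\<bar>\<tau>\<bar> ^ i * norm ((vderiv ^^ (i + j)) F \<tau>)) \<le> B * (C * (N * k powr (1/3)) ^ d)"
      by (intro mult_mono[OF B(2)[OF s]]) (use B(1) in auto)
    then have "k powr \<gamma> * (norm (b s) * (\<bar>\<tau>\<bar> ^ i * norm ((vderiv ^^ (i + j)) F \<tau>)))
        \<le> k powr \<gamma> * (B * (C * (N * k powr (1/3)) ^ d))"
      by (rule mult_left_mono) simp
    moreover have "norm (monomial \<gamma> i j b s k) =
        k powr \<gamma> * (norm (b s) * (\<bar>\<tau>\<bar> ^ i * norm ((vderiv ^^ (i + j)) F \<tau>)))"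
      unfolding monomial_def \<tau>_def[symmetric]
      by (simp add: norm_mult abs_mult power_abs mult_ac)
    moreover have "(k powr (1/3)) ^ d = k powr (real d / 3)"
      using k k0 by (simp add: powr_realpow[symmetric] powr_powr)
    ultimately show ?thesis
      by (simp add: power_mult_distrib powr_add mult_ac)
  qed
  then show ?thesis by blast
qed

lemma powr_le_higher_order:
  fixes \<gamma> \<beta> k k0 :: real
  assumes "\<gamma> \<le> \<beta>" "0 < k0" "k0 \<le> k"
  shows "k powr \<gamma> \<le> k0 powr (\<gamma> - \<beta>) * k powr \<beta>"
proof -
  have "k powr (\<gamma> - \<beta>) * k powr \<beta> \<le> k0 powr (\<gamma> - \<beta>) * k powr \<beta>"
    using assms by (intro mult_right_mono powr_mono2') auto
  then show ?thesis
    using assms by (simp add: powr_add[symmetric])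
qed

lemma bound_of_higher_order:
  fixes a :: "real \<Rightarrow> real \<Rightarrow> complex"
  assumes a: "\<exists>C. \<forall>s\<in>S. \<forall>k\<ge>k0. norm (a s k) \<le> C * k powr \<gamma>"
    and "\<gamma> \<le> \<beta>" "0 < k0"
  shows "\<exists>C. \<forall>s\<in>S. \<forall>k\<ge>k0. norm (a s k) \<le> C * k powr \<beta>"
proof -
  obtain C where C: "\<And>s k. s \<in> S \<Longrightarrow> k \<ge> k0 \<Longrightarrow> norm (a s k) \<le> C * k powr \<gamma>"
    using a by blast
  have "norm (a s k) \<le> (\<bar>C\<bar> * k0 powr (\<gamma> - \<beta>)) * k powr \<beta>" if "s \<in> S" "k \<ge> k0" for s k
  proof -
    have "norm (a s k) \<le> \<bar>C\<bar> * k powr \<gamma>"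
      by (rule order_trans[OF C[OF that]]) (simp add: mult_right_mono)
    also have "\<dots> \<le> \<bar>C\<bar> * (k0 powr (\<gamma> - \<beta>) * k powr \<beta>)"
      by (intro mult_left_mono powr_le_higher_order) (use assms that in auto)
    finally show ?thesis by (simp add: mult_ac)
  qed
  then show ?thesis by blast
qed

lemma amplitude_bound:
  assumes "amplitude \<beta> a" and k0: "k0 > 0"
  shows "\<exists>C. \<forall>s\<in>S. \<forall>k\<ge>k0. norm (a s k) \<le> C * k powr (\<beta> + real d / 3)"
  using assms(1)
proof induction
  case (monomial b \<gamma> \<beta> a c i j)
  obtain C where C: "\<And>s k. s \<in> S \<Longrightarrow> k \<ge> k0 \<Longrightarrow>
      norm (monomial \<gamma> i j b s k) \<le> C * k powr (\<gamma> + real d / 3)"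
    using monomial_bound[OF monomial(1) k0] by blast
  have "norm (a s k) \<le> (\<bar>c\<bar> * C) * k powr (\<gamma> + real d / 3)" if "s \<in> S" "k \<ge> k0" for s k
    using mult_left_mono[OF C[OF that], of "\<bar>c\<bar>"] monomial(3)[of s k] that k0
    by (simp add: mult_ac)
  then have "\<exists>C. \<forall>s\<in>S. \<forall>k\<ge>k0. norm (a s k) \<le> C * k powr (\<gamma> + real d / 3)"
    by (intro exI[of _ "\<bar>c\<bar> * C"] ballI allI impI)
  then show ?case
    by (rule bound_of_higher_order) (use monomial(2) k0 in auto)
next
  case (sum \<beta> a1 a2 a)
  then obtain C1 C2 where C:
    "\<And>s k. s \<in> S \<Longrightarrow> k \<ge> k0 \<Longrightarrow> norm (a1 s k) \<le> C1 * k powr (\<beta> + real d / 3)"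
    "\<And>s k. s \<in> S \<Longrightarrow> k \<ge> k0 \<Longrightarrow> norm (a2 s k) \<le> C2 * k powr (\<beta> + real d / 3)"
    by blast
  have "norm (a s k) \<le> (C1 + C2) * k powr (\<beta> + real d / 3)" if "s \<in> S" "k \<ge> k0" for s k
    using norm_triangle_le[OF add_mono[OF C[OF that]]] sum.hyps(3)[of s k] that k0
    by (simp add: distrib_right)
  then show ?case
    by (intro exI[of _ "C1 + C2"] ballI allI impI)
qed

text \<open>
  Each \<open>k\<close>-derivative gains \<open>1\<close> power of \<open>k\<close>, so every type \<open>\<rho> \<le> 1\<close> is admissible.
\<close>

lemma amplitude_in_hormander_class:
  assumes "amplitude \<beta> a" "\<rho> \<le> 1"
  shows "a \<in> hormander_class (\<beta> + real d / 3) \<rho> (1/3) S"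
proof -
  have "\<exists>C. \<forall>s\<in>S. \<forall>k\<ge>k0. norm ((partial1 S ^^ n) ((partial2 {0<..} ^^ m) a) s k)
      \<le> C * k powr (\<beta> + real d / 3 + 1/3 * real n - \<rho> * real m)" if "k0 > 0" for n m k0
    by (rule bound_of_higher_order[OF amplitude_bound[OF amplitude_iterated_partials[OF assms(1)]]])
       (use that mult_right_mono[OF assms(2), of "real m"] in auto)
  then show ?thesis
    using amplitude_smooth[OF assms(1)] by (simp add: hormander_class_def)
qed

end

section \<open>Profiles with a symbol expansion\<close>

text \<open>
  On a bounded interval continuity suffices; outside it \<open>1 + |\<tau>| \<le> 2 |\<tau>|\<close>. At \<open>-\<infinity>\<close> the decay
  \<open>|\<tau>|\<^sup>-\<^sup>n\<close> is that of a symbol of order \<open>0\<close>, and it is the maximum of the orders \<open>e\<close> and \<open>0\<close> that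
  governs the whole line; \<open>nat e\<close> is this maximum.
\<close>

lemma symbol_bound_from_ends:
  fixes f :: "real \<Rightarrow> 'a::real_normed_vector" and e :: int
  assumes cont: "continuous_on UNIV f"
    and top: "(\<lambda>\<tau>. norm (f \<tau>)) \<in> O[at_top](\<lambda>\<tau>. \<tau> powi (e - int n))"
    and bot: "(\<lambda>\<tau>. norm (f \<tau>)) \<in> O[at_bot](\<lambda>\<tau>. \<bar>\<tau>\<bar> powi (- int n))"
  shows "\<exists>C. \<forall>\<tau>. (1 + \<bar>\<tau>\<bar>) ^ n * norm (f \<tau>) \<le> C * (1 + \<bar>\<tau>\<bar>) ^ nat e"
proof -
  obtain A where A: "A > 0" and "eventually (\<lambda>\<tau>. norm (f \<tau>) \<le> A * norm (\<tau> powi (e - int n))) at_top"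
    using landau_o.bigE[OF top] by auto
  then obtain T where T: "\<And>\<tau>. \<tau> \<ge> T \<Longrightarrow> norm (f \<tau>) \<le> A * norm (\<tau> powi (e - int n))"
    by (auto simp: eventually_at_top_linorder)
  obtain A' where A': "A' > 0" and "eventually (\<lambda>\<tau>. norm (f \<tau>) \<le> A' * norm (\<bar>\<tau>\<bar> powi (- int n))) at_bot"
    using landau_o.bigE[OF bot] by auto
  then obtain T' where T': "\<And>\<tau>. \<tau> \<le> T' \<Longrightarrow> norm (f \<tau>) \<le> A' * norm (\<bar>\<tau>\<bar> powi (- int n))"
    by (auto simp: eventually_at_bot_linorder)
  define R where "R = max 1 (max T (- T'))"
  have "compact ((\<lambda>\<tau>. (1 + \<bar>\<tau>\<bar>) ^ n * norm (f \<tau>)) ` {-R..R})"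
    by (intro compact_continuous_image continuous_intros continuous_on_subset[OF cont]) auto
  then have "bounded ((\<lambda>\<tau>. (1 + \<bar>\<tau>\<bar>) ^ n * norm (f \<tau>)) ` {-R..R})"
    by (rule compact_imp_bounded)
  then obtain B where B: "B > 0" "\<And>\<tau>. \<tau> \<in> {-R..R} \<Longrightarrow> norm ((1 + \<bar>\<tau>\<bar>) ^ n * norm (f \<tau>)) \<le> B"
    unfolding bounded_pos by blast
  define C where "C = B + 2 ^ n * A + 2 ^ n * A'"
  \<comment> \<open>Both ends at once: \<open>e' = e\<close> is used for \<open>\<tau> \<ge> R\<close> and \<open>e' = 0\<close> for \<open>\<tau> \<le> -R\<close>.\<close>
  have far: "(1 + \<bar>\<tau>\<bar>) ^ n * norm (f \<tau>) \<le> 2 ^ n * K * (1 + \<bar>\<tau>\<bar>) ^ nat e"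
    if "\<bar>\<tau>\<bar> \<ge> 1" "K > 0" and le: "norm (f \<tau>) \<le> K * \<bar>\<tau>\<bar> powi (e' - int n)" and e': "e' = e \<or> e' = 0" for \<tau> K e'
  proof -
    have p: "\<bar>\<tau>\<bar> powi e' = \<bar>\<tau>\<bar> ^ n * \<bar>\<tau>\<bar> powi (e' - int n)"
      using that(1) by (subst power_int_diff) (auto simp: divide_simps)
    have "(1 + \<bar>\<tau>\<bar>) ^ n * norm (f \<tau>) \<le> (2 * \<bar>\<tau>\<bar>) ^ n * (K * \<bar>\<tau>\<bar> powi (e' - int n))"
      using that by (intro mult_mono power_mono) auto
    also have "\<dots> = 2 ^ n * K * \<bar>\<tau>\<bar> powi e'"
      unfolding p by (simp add: power_mult_distrib mult_ac)
    also have "\<dots> \<le> 2 ^ n * K * (1 + \<bar>\<tau>\<bar>) ^ nat e"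
    proof (rule mult_left_mono)
      have "\<bar>\<tau>\<bar> powi e' \<le> \<bar>\<tau>\<bar> powi int (nat e)"
        using that(1) e' by (intro power_int_increasing) auto
      also have "\<dots> \<le> (1 + \<bar>\<tau>\<bar>) ^ nat e"
        unfolding power_int_of_nat by (intro power_mono) auto
      finally show "\<bar>\<tau>\<bar> powi e' \<le> (1 + \<bar>\<tau>\<bar>) ^ nat e" .
    qed (use that(2) in simp)
    finally show ?thesis .
  qed
  have "(1 + \<bar>\<tau>\<bar>) ^ n * norm (f \<tau>) \<le> C * (1 + \<bar>\<tau>\<bar>) ^ nat e" for \<tau>
  proof -
    have one: "(1::real) \<le> (1 + \<bar>\<tau>\<bar>) ^ nat e"
      by simp
    consider "\<tau> \<ge> R" | "\<tau> \<le> -R" | "\<tau> \<in> {-R..R}"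
      by fastforce
    then have "\<exists>C'\<le>C. (1 + \<bar>\<tau>\<bar>) ^ n * norm (f \<tau>) \<le> C' * (1 + \<bar>\<tau>\<bar>) ^ nat e"
    proof cases
      case 1
      then have "\<tau> \<ge> 1" "\<tau> \<ge> T"
        by (auto simp: R_def)
      then have "(1 + \<bar>\<tau>\<bar>) ^ n * norm (f \<tau>) \<le> 2 ^ n * A * (1 + \<bar>\<tau>\<bar>) ^ nat e"
        using T[of \<tau>] A by (intro far[where e' = e]) (auto simp: power_int_abs)
      then show ?thesis
        using B A A' by (intro exI[of _ "2 ^ n * A"]) (auto simp: C_def)
    next
      case 2
      then have "\<bar>\<tau>\<bar> \<ge> 1" "\<tau> \<le> T'"
        by (auto simp: R_def)
      then have "(1 + \<bar>\<tau>\<bar>) ^ n * norm (f \<tau>) \<le> 2 ^ n * A' * (1 + \<bar>\<tau>\<bar>) ^ nat e"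
        using T'[of \<tau>] A' by (intro far[where e' = 0]) (auto simp: power_int_abs)
      then show ?thesis
        using B A A' by (intro exI[of _ "2 ^ n * A'"]) (auto simp: C_def)
    next
      case 3
      then have "(1 + \<bar>\<tau>\<bar>) ^ n * norm (f \<tau>) \<le> B * 1"
        using B(2) by fastforce
      also have "\<dots> \<le> B * (1 + \<bar>\<tau>\<bar>) ^ nat e"
        using B(1) one by (intro mult_left_mono) auto
      finally show ?thesis
        using A A' by (intro exI[of _ B]) (auto simp: C_def)
    qed
    then show ?thesis
      by (meson one mult_right_mono order_trans zero_le_one)
  qed
  then show ?thesis by blast
qed

theorem lemma4:
  fixes P t1 t2 :: real
    and Z :: "real \<Rightarrow> real"
    and b :: "nat \<Rightarrow> nat \<Rightarrow> nat \<Rightarrow> int \<Rightarrow> real \<Rightarrow> complex"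
    and \<Psi> :: "nat \<Rightarrow> int \<Rightarrow> real \<Rightarrow> complex"
    and c :: "nat \<Rightarrow> int \<Rightarrow> nat \<Rightarrow> complex"
    and p q r :: nat and l :: int
  assumes "P > 0" and "0 < t1" and "t1 < t2" and "t2 < 2 * P" and "t1 + t2 = 2 * P"
    and b_smooth: "\<And>p q r l. smooth (b p q r l)"
    and b_periodic: "\<And>p q r l. periodic_fun_simple (b p q r l) (2 * P)"
    and Z_smooth: "smooth Z"
    and Z_periodic: "periodic_fun_simple Z (2 * P)"
    and Z_illuminated: "\<And>s. s \<in> {t1<..<t2} \<Longrightarrow> Z s > 0"
    and Z_shadow: "\<And>s. s \<in> {0..<t1} \<union> {t2<..2 * P} \<Longrightarrow> Z s < 0"
    and Z_zero: "Z t1 = 0" "Z t2 = 0"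
    and Z_first_order: "deriv Z t1 \<noteq> 0" "deriv Z t2 \<noteq> 0"
    and \<Psi>_smooth: "\<And>r l. smooth (\<Psi> r l)"
    and \<Psi>_expansion: "\<And>r l. symbol_expansion (\<Psi> r l) (1 + l - 2 * int r) (c r l)"
    and \<Psi>_decrease: "\<And>r l. rapidly_decreasing_at_bot (\<Psi> r l)"
  shows "expansion_term b \<Psi> Z p q r l
           \<in> hormander_class (symbol_order p q r l) (2/3) (1/3) {0..2 * P}"
proof -
  define e where "e = 1 + l - 2 * int r - int p"
  have iterate: "(vderiv ^^ n) ((vderiv ^^ p) (\<Psi> r l)) = (vderiv ^^ (p + n)) (\<Psi> r l)" for n
    by (metis add.commute comp_apply funpow_add)
  have \<Psi>_bound: "\<exists>C. \<forall>\<tau>. (1 + \<bar>\<tau>\<bar>) ^ n * norm ((vderiv ^^ n) ((vderiv ^^ p) (\<Psi> r l)) \<tau>)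
      \<le> C * (1 + \<bar>\<tau>\<bar>) ^ nat e" for n
    unfolding iterate
  proof (rule symbol_bound_from_ends)
    show "continuous_on UNIV ((vderiv ^^ (p + n)) (\<Psi> r l))"
      using smooth_continuous_on smooth_iterate \<Psi>_smooth by blast
    \<comment> \<open>With no terms subtracted, the expansion is a bound on the derivatives of \<open>\<Psi>\<close>.\<close>
    show "(\<lambda>\<tau>. norm ((vderiv ^^ (p + n)) (\<Psi> r l) \<tau>)) \<in> O[at_top](\<lambda>\<tau>. \<tau> powi (e - int n))"
      using \<Psi>_expansion[of r l, unfolded symbol_expansion_def, rule_format, of "p + n" 0]
      by (simp add: e_def algebra_simps)
    show "(\<lambda>\<tau>. norm ((vderiv ^^ (p + n)) (\<Psi> r l) \<tau>)) \<in> O[at_bot](\<lambda>\<tau>. \<bar>\<tau>\<bar> powi (- int n))"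
      using \<Psi>_decrease unfolding rapidly_decreasing_at_bot_def by blast
  qed
  interpret symbol_of_scaled_phase "{0..2 * P}" Z "(vderiv ^^ p) (\<Psi> r l)" "nat e"
  proof
    show "at s within {0..2 * P} \<noteq> bot" if "s \<in> {0..2 * P}" for s
      using that \<open>P > 0\<close> by (simp add: trivial_limit_within)
  qed (use Z_smooth \<Psi>_smooth smooth_iterate \<Psi>_bound in auto)
  have "amplitude (base_exponent p q r l) (expansion_term b \<Psi> Z p q r l)"
    by (rule amplitude.monomial[OF b_smooth order_refl, where c = 1 and i = 0 and j = 0])
       (auto simp: expansion_term_def monomial_def scaleR_conv_of_real)
  then have "expansion_term b \<Psi> Z p q r l
      \<in> hormander_class (base_exponent p q r l + real (nat e) / 3) (2/3) (1/3) {0..2 * P}"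
    by (rule amplitude_in_hormander_class) simp
  also have "base_exponent p q r l + real (nat e) / 3 = symbol_order p q r l"
    by (auto simp: symbol_order_def e_def Let_def)
  finally show ?thesis .
qed

end
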